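(* Let $p\geq 5$ be a prime, and let $x$ and $y$ be non-zero (rational) integers satisfying $x^p-4y^p=4$. Then $$x=4^{1/p}\,y\sum_{i=0}^{\infty}\binom{1/p}{i}\frac{1}{y^{pi}}.$$
   Context: Here $4^{1/p}$ denotes the real $p$-th root of $4$, the index $i$ in the sum is a summation index running over non-negative integers, and $\binom{1/p}{i}=\frac{(1/p)(1/p-1)\cdots(1/p-i+1)}{i!}$ is the generalized binomial coefficient (equal to $1$ for $i=0$). *)

theory Defs
  imports Complex_Main "HOL-Computational_Algebra.Primes"
begin

end

theory Submission
  imports Defs "HOL-Analysis.Generalised_Binomial_Theorem"
begin

text \<open>
  Reading the equation as \<open>x ^ p = 4 * y ^ p * (1 + z)\<close> with \<open>z = 1 / y ^ p\<close> and taking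
  the real \<open>p\<close>-th root, which is unambiguous and multiplicative because \<open>p\<close> is odd, gives
  \<open>x = root p 4 * y * root p (1 + z)\<close>. Newton's binomial series for \<open>(1 + z) powr (1 / p)\<close>
  then yields the claim as soon as \<open>\<bar>z\<bar> < 1\<close>, that is, \<open>\<bar>y\<bar> > 1\<close>. The boundary
  values of \<open>y\<close> do not occur: \<open>y = 1\<close> would make 8 a \<open>p\<close>-th power, and \<open>y = - 1\<close> would
  force \<open>x = 0\<close>.
\<close>

text \<open>The \<open>p\<close>-th powers nearest to 8 are 1 and \<open>2 ^ p \<ge> 16\<close>.\<close>

lemma odd_power_neq_8:
  fixes x :: int
  assumes "odd p" and "p \<ge> 4"
  shows "x ^ p \<noteq> 8"
proof
  assume eq: "x ^ p = 8"
  have "x > 0"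
    using zero_less_power_eq[of x p] eq \<open>odd p\<close> by auto
  moreover have "x \<noteq> 1"
    using eq by auto
  ultimately have "x \<ge> 2" by linarith
  have "(2::int) ^ 4 \<le> 2 ^ p"
    using \<open>p \<ge> 4\<close> by (intro power_increasing) auto
  also have "\<dots> \<le> x ^ p"
    using \<open>x \<ge> 2\<close> by (intro power_mono) auto
  finally show False using eq by simp
qed

lemma abs_gt_1_of_power_eq:
  fixes x y :: int
  assumes "odd p" and "p \<ge> 4" and "x \<noteq> 0" and "y \<noteq> 0" and eq: "x ^ p - 4 * y ^ p = 4"
  shows "\<bar>y\<bar> > 1"
proof (rule ccontr)
  assume "\<not> \<bar>y\<bar> > 1"
  with \<open>y \<noteq> 0\<close> consider "y = 1" | "y = - 1" by linarith
  then show False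
  proof cases
    case 1
    then show False using eq odd_power_neq_8[OF assms(1,2), of x] by simp
  next
    case 2
    then show False using eq \<open>odd p\<close> \<open>x \<noteq> 0\<close> by simp
  qed
qed

lemma root_binomial_series:
  fixes z :: real
  assumes "n > 0" and "\<bar>z\<bar> < 1"
  shows "(\<lambda>i. ((1 / real n) gchoose i) * z ^ i) sums root n (1 + z)"
  using gen_binomial_real[OF assms(2), of "1 / real n"] assms
  by (simp add: root_powr_inverse)

theorem lemma1:
  fixes p :: nat and x y :: int
  assumes "prime p" and "p \<ge> 5"
    and "x \<noteq> 0" and "y \<noteq> 0"
    and "x ^ p - 4 * y ^ p = 4"
  shows "summable (\<lambda>i. ((1 / real p) gchoose i) * (1 / real_of_int y ^ (p * i))) \<and>
    real_of_int x = root p 4 * real_of_int y *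
      (\<Sum>i. ((1 / real p) gchoose i) * (1 / real_of_int y ^ (p * i)))"
proof -
  have "odd p"
    using prime_odd_nat[OF assms(1)] assms(2) by linarith
  have "p > 0" using assms(2) by simp
  have "\<bar>y\<bar> > 1"
    using abs_gt_1_of_power_eq[OF \<open>odd p\<close> _ assms(3-5)] assms(2) by simp
  define z where "z = 1 / real_of_int y ^ p"
  have "\<bar>real_of_int y\<bar> ^ p > 1"
    using \<open>\<bar>y\<bar> > 1\<close> \<open>p > 0\<close> by (intro one_less_power) linarith+
  then have "\<bar>z\<bar> < 1"
    by (simp add: z_def power_abs divide_less_eq)
  have z_power: "z ^ i = 1 / real_of_int y ^ (p * i)" for i
    by (simp add: z_def power_divide power_mult)
  have series: "(\<lambda>i. ((1 / real p) gchoose i) * (1 / real_of_int y ^ (p * i))) sums root p (1 + z)"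
    using root_binomial_series[OF \<open>p > 0\<close> \<open>\<bar>z\<bar> < 1\<close>] by (simp only: z_power)
  have "real_of_int x ^ p - 4 * real_of_int y ^ p = 4"
    using arg_cong[OF assms(5), of real_of_int] by simp
  then have "real_of_int x ^ p = 4 * real_of_int y ^ p * (1 + z)"
    using assms(4) by (simp add: z_def field_simps)
  then have "root p (real_of_int x ^ p) = root p (4 * real_of_int y ^ p * (1 + z))"
    by simp
  then have "real_of_int x = root p 4 * real_of_int y * root p (1 + z)"
    using \<open>odd p\<close> by (simp add: real_root_mult odd_real_root_power_cancel)
  then show ?thesis
    using series by (simp add: sums_iff)
qed

end
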